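(* There is a countably infinite graph $G=(V,E)$ with edge-disjoint spanning trees $T_0$ and $T_1$ such that there is a bipartition $E(T_0)=X_0\cup X_1$ for which there are no edge-disjoint spanning trees $S_0$ and $S_1$ of $G$ with $E(T_0)\cap E(S_i)=X_i$ for both $i\in\{0,1\}$.
   Context: A spanning tree of a (possibly infinite) graph $G=(V,E)$ is a connected subgraph with vertex set $V$ containing no (finite) cycle. For a graph $H$, $E(H)$ denotes its edge set. A bipartition $E(T_0)=X_0\cup X_1$ means that $X_0$ and $X_1$ are disjoint and their union is $E(T_0)$. *)

theory Defs
  imports "HOL-Library.Ramsey" "HOL-Library.Countable_Set"
begin

text \<open>Simple undirected graphs, finite or infinite: edges are 2-element sets of vertices.\<close>

record 'a sgraph =
  verts :: "'a set"
  edges :: "'a set set"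

definition is_graph :: "'a sgraph \<Rightarrow> bool" where
  "is_graph G \<longleftrightarrow> edges G \<subseteq> [verts G]\<^bsup>2\<^esup>"

definition subgraph_of :: "'a sgraph \<Rightarrow> 'a sgraph \<Rightarrow> bool" where
  "subgraph_of H G \<longleftrightarrow> is_graph H \<and> verts H \<subseteq> verts G \<and> edges H \<subseteq> edges G"

text \<open>Paths and cycles are given by their (finite) list of pairwise distinct vertices. A path
  may consist of a single vertex. A cycle is listed without repeating its first vertex; the
  bound on the length keeps a single edge, traversed back and forth, from counting as a cycle.\<close>

definition is_path :: "'a sgraph \<Rightarrow> 'a list \<Rightarrow> bool" where
  "is_path G p \<longleftrightarrow> p \<noteq> [] \<and> distinct p \<and> set p \<subseteq> verts G \<and>
     successively (\<lambda>x y. {x, y} \<in> edges G) p"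

definition is_cycle :: "'a sgraph \<Rightarrow> 'a list \<Rightarrow> bool" where
  "is_cycle G p \<longleftrightarrow> is_path G p \<and> length p \<ge> 3 \<and> {last p, hd p} \<in> edges G"

definition connected_graph :: "'a sgraph \<Rightarrow> bool" where
  "connected_graph G \<longleftrightarrow> verts G \<noteq> {} \<and>
     (\<forall>x \<in> verts G. \<forall>y \<in> verts G. \<exists>p. is_path G p \<and> hd p = x \<and> last p = y)"

definition spanning_tree :: "'a sgraph \<Rightarrow> 'a sgraph \<Rightarrow> bool" where
  "spanning_tree T G \<longleftrightarrow> subgraph_of T G \<and> verts T = verts G \<and> connected_graph T \<and>
     \<not> (\<exists>p. is_cycle T p)"

definition edge_disjoint :: "'a sgraph \<Rightarrow> 'a sgraph \<Rightarrow> bool" where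
  "edge_disjoint H K \<longleftrightarrow> edges H \<inter> edges K = {}"

end

theory Submission
  imports Defs
begin

text \<open>
  Write \<open>c = 0\<close>, \<open>v\<^sub>i = 2 i + 1\<close> and \<open>w\<^sub>i = 2 i + 2\<close>. Let \<open>T\<^sub>0\<close> consist of the edges
  \<open>c v\<^sub>i\<close> and \<open>w\<^sub>i v\<^bsub>i+1\<^esub>\<close>, let \<open>T\<^sub>1\<close> consist of the edges \<open>c w\<^sub>i\<close> and \<open>v\<^sub>i w\<^sub>i\<close>, take \<open>G = T\<^sub>0 \<union> T\<^sub>1\<close>, and put
  \<open>X\<^sub>1 = {c v\<^sub>i}\<close>, \<open>X\<^sub>0 = {w\<^sub>i v\<^bsub>i+1\<^esub>}\<close>. As \<open>S\<^sub>1\<close> must reach \<open>w\<^sub>i\<close> without \<open>X\<^sub>0\<close>, it contains one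
  of \<open>c w\<^sub>i\<close> and \<open>v\<^sub>i w\<^sub>i\<close>, so \<open>S\<^sub>0\<close> contains at most one of them. Walking in \<open>S\<^sub>0\<close> from \<open>v\<^sub>0\<close>,
  one can therefore only proceed along \<open>v\<^sub>0 w\<^sub>0 v\<^sub>1 w\<^sub>1 \<dots>\<close>, and the first \<open>i\<close> with \<open>c w\<^sub>i\<close> in \<open>S\<^sub>0\<close>
  is one with \<open>v\<^sub>i w\<^sub>i\<close> not in \<open>S\<^sub>0\<close>: the vertex \<open>c\<close> is never reached.
\<close>

text \<open>If \<open>z\<close> already lies on \<open>p\<close>, cutting \<open>p\<close> off at
  \<open>z\<close> keeps the vertices distinct. Thus a walk becomes a path edge by edge.\<close>

lemma is_path_snoc:
  assumes "is_path G p" "{last p, z} \<in> edges G" "z \<in> verts G"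
  shows "\<exists>q. is_path G q \<and> hd q = hd p \<and> last q = z"
proof (cases "z \<in> set p")
  case True
  then obtain xs ys where p: "p = (xs @ [z]) @ ys"
    by (metis append.assoc append_Cons append_Nil split_list)
  have "is_path G (xs @ [z])"
    using assms(1) unfolding is_path_def p by (auto simp: successively_append_iff)
  moreover have "hd (xs @ [z]) = hd p"
    unfolding p by (cases xs) auto
  ultimately show ?thesis by (metis last_snoc)
next
  case False
  then have "is_path G (p @ [z])"
    using assms unfolding is_path_def by (auto simp: successively_append_iff)
  moreover have "hd (p @ [z]) = hd p"
    using assms(1) by (simp add: is_path_def)
  ultimately show ?thesis by (metis last_snoc)
qed

lemma path_if_reachable:
  assumes "(\<lambda>x y. {x, y} \<in> edges G)\<^sup>*\<^sup>* x y" "x \<in> verts G" "\<Union> (edges G) \<subseteq> verts G"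
  shows "\<exists>p. is_path G p \<and> hd p = x \<and> last p = y"
  using assms(1)
proof (induction rule: rtranclp_induct)
  case base
  have "is_path G [x]" using assms(2) by (simp add: is_path_def)
  then show ?case by (intro exI[of _ "[x]"]) simp
next
  case (step y z)
  then obtain p where p: "is_path G p" "hd p = x" "last p = y" by blast
  moreover have "z \<in> verts G" using step.hyps(2) assms(3) by blast
  ultimately show ?case using is_path_snoc[of G p z] step.hyps(2) by auto
qed

lemma connected_graph_cut_edge:
  assumes "connected_graph G" "x \<in> verts G" "y \<in> verts G" "x \<in> U" "y \<notin> U"
  obtains a b where "{a, b} \<in> edges G" "a \<in> U" "b \<notin> U"
proof -
  obtain p where p: "is_path G p" "hd p = x" "last p = y"
    using assms unfolding connected_graph_def by blast
  have "\<exists>a b. {a, b} \<in> edges G \<and> a \<in> U \<and> b \<notin> U"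
    if "p \<noteq> []" "successively (\<lambda>x y. {x, y} \<in> edges G) p" "hd p \<in> U" "last p \<notin> U" for p
    using that by (induction p rule: induct_list012) auto
  then show ?thesis using p assms(4,5) that unfolding is_path_def by metis
qed

text \<open>The cyclic predecessor and successor of \<open>v\<close> differ because a cycle has at
  least three vertices.\<close>

lemma cycle_neighbours:
  assumes "is_cycle G p" "v \<in> set p"
  obtains a b where "a \<noteq> b" "a \<in> set p" "b \<in> set p" "{v, a} \<in> edges G" "{v, b} \<in> edges G"
proof -
  have len: "length p \<ge> 3" and dist: "distinct p"
    and suc: "successively (\<lambda>x y. {x, y} \<in> edges G) p"
    and clo: "{last p, hd p} \<in> edges G"
    using assms(1) by (auto simp: is_cycle_def is_path_def)
  obtain i where i: "i < length p" "v = p ! i"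
    using assms(2) by (metis in_set_conv_nth)
  have step: "{p ! k, p ! Suc k} \<in> edges G" if "Suc k < length p" for k
    using suc that by (simp add: successively_conv_nth)
  have wrap: "{p ! (length p - 1), p ! 0} \<in> edges G"
    using clo len by (simp add: last_conv_nth hd_conv_nth flip: length_greater_0_conv)
  define j where "j = (if Suc i < length p then Suc i else 0)"
  define k where "k = (if i = 0 then length p - 1 else i - 1)"
  have jk: "j < length p" "k < length p" "j \<noteq> k"
    using i(1) len by (auto simp: j_def k_def)
  have "{p ! i, p ! j} \<in> edges G"
  proof (cases "Suc i < length p")
    case False
    then have "i = length p - 1" using i(1) by simp
    then show ?thesis using wrap False by (simp add: j_def)
  qed (simp add: j_def step)
  moreover have "{p ! i, p ! k} \<in> edges G"
    using step[of "i - 1"] wrap i(1) by (cases i) (auto simp: k_def insert_commute)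
  ultimately show ?thesis
    using that[of "p ! j" "p ! k"] jk dist i(2) by (simp add: nth_eq_iff_index_eq)
qed

definition parent_graph :: "'a \<Rightarrow> ('a \<Rightarrow> 'a) \<Rightarrow> 'a sgraph" where
  "parent_graph r par = \<lparr>verts = UNIV, edges = {{x, par x} | x. x \<noteq> r}\<rparr>"

lemma edges_parent_graph_If:
  "edges (parent_graph r (\<lambda>x. if P x then f x else g x)) =
    {{x, f x} | x. x \<noteq> r \<and> P x} \<union> {{x, g x} | x. x \<noteq> r \<and> \<not> P x}"
  by (auto simp: parent_graph_def)

text \<open>Passing to the parent lowers \<open>h\<close>, so each vertex reaches the root by
  induction on \<open>h\<close>, and a highest vertex of a cycle would have two parents.\<close>

lemma spanning_tree_parent_graph:
  fixes h :: "'a \<Rightarrow> nat"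
  assumes h: "\<And>x. x \<noteq> r \<Longrightarrow> h (par x) < h x"
    and G: "verts G = UNIV" "edges (parent_graph r par) \<subseteq> edges G"
  shows "spanning_tree (parent_graph r par) G"
proof -
  let ?T = "parent_graph r par"
  let ?E = "\<lambda>x y. {x, y} \<in> edges ?T"
  have V: "verts ?T = UNIV" by (simp add: parent_graph_def)
  have E: "?E x y \<longleftrightarrow> (x \<noteq> r \<and> y = par x) \<or> (y \<noteq> r \<and> x = par y)" for x y
    by (auto simp: parent_graph_def doubleton_eq_iff)
  have "x \<noteq> par x" if "x \<noteq> r" for x using h[OF that] by auto
  then have "is_graph ?T"
    by (auto simp: is_graph_def parent_graph_def nsets_def)
  then have sub: "subgraph_of ?T G"
    using G V by (simp add: subgraph_of_def)
  have root: "?E\<^sup>*\<^sup>* x r" for x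
  proof (induction "h x" arbitrary: x rule: less_induct)
    case less
    show ?case
    proof (cases "x = r")
      case False
      then have "?E\<^sup>*\<^sup>* (par x) r" using h less by blast
      moreover have "?E x (par x)" using E False by blast
      ultimately show ?thesis by (rule converse_rtranclp_into_rtranclp[rotated])
    qed simp
  qed
  have "symp ?E\<^sup>*\<^sup>*"
    by (intro symp_rtranclp) (simp add: symp_def insert_commute)
  then have "?E\<^sup>*\<^sup>* x y" for x y
    using root by (meson rtranclp_trans sympD)
  then have conn: "connected_graph ?T"
    unfolding connected_graph_def using path_if_reachable V by fastforce
  \<comment> \<open>Both neighbours of a vertex of maximal height on a cycle would be its parent.\<close>
  have "\<not> is_cycle ?T p" for p
  proof
    assume p: "is_cycle ?T p"
    then have "Max (h ` set p) \<in> h ` set p" by (intro Max_in) (auto simp: is_cycle_def is_path_def)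
    then obtain v where v: "v \<in> set p" "h v = Max (h ` set p)" by auto
    then have v_max: "h u \<le> h v" if "u \<in> set p" for u using that by simp
    have "u = par v" if "u \<in> set p" "?E v u" for u
      using that E h v_max by (metis leD)
    then show False using cycle_neighbours[OF p v(1)] by metis
  qed
  then show ?thesis using sub V G conn by (simp add: spanning_tree_def)
qed

theorem theorem1p3:
  shows "\<exists>G :: nat sgraph.
    is_graph G \<and> countable (verts G) \<and> infinite (verts G) \<and>
    (\<exists>T0 T1. spanning_tree T0 G \<and> spanning_tree T1 G \<and> edge_disjoint T0 T1 \<and>
      (\<exists>X0 X1. X0 \<union> X1 = edges T0 \<and> X0 \<inter> X1 = {} \<and>
        \<not> (\<exists>S0 S1. spanning_tree S0 G \<and> spanning_tree S1 G \<and> edge_disjoint S0 S1 \<and>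
              edges T0 \<inter> edges S0 = X0 \<and> edges T0 \<inter> edges S1 = X1)))"
proof -
  \<comment> \<open>In this numbering every edge of \<open>T0\<close> or \<open>T1\<close> avoiding
    0 has the form \<open>{n, Suc n}\<close>, so the walk of the introduction is 1, 2, 3,
    ...\<close>
  define T0 where "T0 = parent_graph (0::nat) (\<lambda>n. if odd n then 0 else Suc n)"
  define T1 where "T1 = parent_graph (0::nat) (\<lambda>n. if even n then 0 else Suc n)"
  define G where "G = \<lparr>verts = UNIV, edges = edges T0 \<union> edges T1\<rparr>"
  define X0 where "X0 = {{n, Suc n} | n. n \<noteq> 0 \<and> even n}"
  define X1 where "X1 = {{n, 0} | n::nat. n \<noteq> 0 \<and> odd n}"
  have T0: "edges T0 = X0 \<union> X1"
    unfolding T0_def edges_parent_graph_If X0_def X1_def by blast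
  have T1: "edges T1 = {{n, Suc n} | n. n \<noteq> 0 \<and> odd n} \<union> {{n, 0} | n. n \<noteq> 0 \<and> even n}"
    unfolding T1_def edges_parent_graph_If by blast
  have tree0: "spanning_tree T0 G"
    unfolding T0_def
    \<comment> \<open>\<open>h\<close> is the distance from 0 in the tree.\<close>
    by (rule spanning_tree_parent_graph[where h = "\<lambda>n. if n = 0 then 0 else if odd n then 1 else 2"])
      (auto simp: G_def T0_def)
  have tree1: "spanning_tree T1 G"
    unfolding T1_def
    by (rule spanning_tree_parent_graph[where h = "\<lambda>n. if n = 0 then 0 else if even n then 1 else 2"])
      (auto simp: G_def T1_def)
  have graph: "is_graph G"
    using tree0 tree1 by (auto simp: spanning_tree_def subgraph_of_def is_graph_def G_def)
  have disj: "edge_disjoint T0 T1"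
    unfolding edge_disjoint_def T0 T1 X0_def X1_def
    by (auto simp: doubleton_eq_iff)
  have X: "X0 \<inter> X1 = {}"
    by (auto simp: X0_def X1_def doubleton_eq_iff)
  have no_exchange: False
    if S: "spanning_tree S0 G" "spanning_tree S1 G" "edge_disjoint S0 S1"
      "edges T0 \<inter> edges S0 = X0" "edges T0 \<inter> edges S1 = X1" for S0 S1
  proof -
    have conn: "connected_graph S0" "connected_graph S1"
      and verts: "verts S0 = UNIV" "verts S1 = UNIV"
      and sub: "edges S0 \<subseteq> edges G" "edges S1 \<subseteq> edges G"
      using S by (auto simp: spanning_tree_def subgraph_of_def G_def)
    have G: "edges G = X0 \<union> X1 \<union> edges T1"
      by (simp add: G_def T0)
    have S0: "e \<in> X0 \<union> edges T1" if "e \<in> edges S0" for e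
      using that sub(1) S(4) X T0 G by blast
    have S1: "e \<in> X1 \<union> edges T1" if "e \<in> edges S1" for e
      using that sub(2) S(5) X T0 G by blast
    have odd: "{0, n} \<notin> edges S0" if "odd n" for n
      using S0[of "{0, n}"] that by (auto simp: X0_def T1 doubleton_eq_iff)
    \<comment> \<open>\<open>L\<close> is the stretch of 1, 2, 3, ... before the first neighbour of
      0 in \<open>S0\<close>. It will turn out that no edge of \<open>S0\<close> leaves it.\<close>
    define L where "L = {n::nat. n \<noteq> 0 \<and> (\<forall>m. 0 < m \<and> m \<le> n \<longrightarrow> {0, m} \<notin> edges S0)}"
    have "1 \<in> L"
      using odd by (auto simp: L_def le_Suc_eq)
    moreover have "0 \<notin> L" by (simp add: L_def)
    ultimately obtain a b where ab: "{a, b} \<in> edges S0" "a \<in> L" "b \<notin> L"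
      using connected_graph_cut_edge[OF conn(1), of 1 0 L] verts by auto
    have "b \<noteq> 0"
      using ab by (auto simp: L_def insert_commute)
    moreover have "a \<noteq> 0" using ab by (simp add: L_def)
    ultimately have "b = Suc a \<or> a = Suc b"
      using S0[OF ab(1)] by (auto simp: X0_def T1 doubleton_eq_iff)
    \<comment> \<open>Below \<open>a\<close>, all positive numbers lie in \<open>L\<close>, so the
      edge can only leave \<open>L\<close> upwards.\<close>
    then have b: "b = Suc a"
      using ab \<open>b \<noteq> 0\<close> by (auto simp: L_def)
    then have 0: "{0, b} \<in> edges S0"
      using ab by (auto simp: L_def le_Suc_eq)
    then have "even b" using odd by blast
    \<comment> \<open>\<open>S1\<close> needs an edge at the even vertex \<open>b\<close>. As
      \<open>{b, Suc b}\<close> is in \<open>X0\<close>, only \<open>{a, b}\<close> and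
      \<open>{0, b}\<close> remain, and \<open>S0\<close> already has both.\<close>
    obtain x y where xy: "{x, y} \<in> edges S1" "x = b" "y \<noteq> b"
      using connected_graph_cut_edge[OF conn(2), of b 0 "{b}"] verts \<open>b \<noteq> 0\<close> by auto
    then have "{b, y} = {a, b} \<or> {b, y} = {0, b}"
      using S1[OF xy(1)] \<open>even b\<close> \<open>b \<noteq> 0\<close> b
      by (auto simp: X1_def T1 doubleton_eq_iff)
    then show False
      using xy ab(1) 0 S(3) by (auto simp: edge_disjoint_def)
  qed
  have "X0 \<union> X1 = edges T0 \<and> X0 \<inter> X1 = {} \<and>
      \<not> (\<exists>S0 S1. spanning_tree S0 G \<and> spanning_tree S1 G \<and> edge_disjoint S0 S1 \<and>
        edges T0 \<inter> edges S0 = X0 \<and> edges T0 \<inter> edges S1 = X1)"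
    using T0 X no_exchange by blast
  moreover have "countable (verts G)" "infinite (verts G)"
    by (simp_all add: G_def)
  ultimately show ?thesis
    using graph tree0 tree1 disj by blast
qed

end
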